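(* Let $\theta^{(1)},\theta^{(-1)}\in\{-1,1\}^d$ and $0<t\le 1/2$, let $D=\mathrm{Bernoulli}(\theta^{(1)},\theta^{(-1)},t)$ be the uniform mixture of two multivariate Bernoulli distributions on $\{-1,1\}^d\times\{-1,1\}$, and let $k=\|\theta^{(1)}-\theta^{(-1)}\|_0$. Let $\epsilon$ be a positive integer and consider $\ell_0$ perturbations of size at most $\epsilon$. For $x\in\{-1,1\}^d$ let $x'$ and $\theta'^{(1)}$ denote the restrictions of $x$ and $\theta^{(1)}$ to the $k$ coordinates in which $\theta^{(1)}$ and $\theta^{(-1)}$ differ. Assume that the $(0,\epsilon)$-optimal robust classifier gives the same label to $u$ and $v$ for all $u,v\in\{-1,1\}^d$ with $\|u'-\theta'^{(1)}\|_0=\|v'-\theta'^{(1)}\|_0$. Then there is a threshold $s\in\{0,1,\dots,k\}$ such that: 1. the $(0,\epsilon)$-optimal robust classifier $h^{\star(adv)}:\{-1,1\}^d\to\{-1,1\}$ on $D$ is of the form $$h^{\star(adv)}(x)=\begin{cases}1, & \|x'-\theta'^{(1)}\|_0\le s,\\ -1, & \text{otherwise};\end{cases}$$ 2. the $(0,\epsilon)$-optimal classification error rate on $D$ is $$\frac12\sum_{i=0}^{s+\epsilon}\binom{k}{i}\left(\tfrac12+t\right)^i\left(\tfrac12-t\right)^{k-i}+\frac12\sum_{i=0}^{k-s+\epsilon-1}\binom{k}{i}\left(\tfrac12+t\right)^i\left(\tfrac12-t\right)^{k-i}.$$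
   Context: Under $\mathrm{Bernoulli}(\theta^{(1)},\theta^{(-1)},t)$, the label $y$ is uniform on $\{-1,1\}$ and, given $y$, the coordinates $x_1,\dots,x_d$ are independent with $x_i=\theta_i^{(y)}$ with probability $1/2+t$ and $x_i=-\theta_i^{(y)}$ with probability $1/2-t$. $\|v\|_0$ is the number of nonzero coordinates of $v$. Classifiers are functions $h:\{-1,1\}^d\to\{-1,1\}$, and perturbed points are required to lie in $\{-1,1\}^d$. The adversarial error rate is $$R^{(adv)}_{0,\epsilon}(h,D)=\mathbb{E}_{(x,y)\sim D}\left\{\mathbb{I}\left(\exists z\in\{-1,1\}^d,\ \|z-x\|_0\le\epsilon : h(z)\ne y\right)\right\}.$$ A classifier is $(0,\epsilon)$-optimal robust on $D$ if it minimizes $R^{(adv)}_{0,\epsilon}(\cdot,D)$ among classifiers, and the minimal value is the $(0,\epsilon)$-optimal classification error rate. Binomial coefficients $\binom{k}{i}$ with $i>k$ are $0$, so those terms of the sums vanish.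
   Formalization: The optimal robust classifier is additionally assumed nonconstant (for d=k=ε=1, t=1/4 only constants are optimal and the rate formula fails); as it need not be unique, the same-label assumption is made for every optimal classifier and the conclusion holds for any nonconstant one. *)

theory Defs
  imports "HOL-Probability.Probability"
begin

definition l0norm :: "real ^ 'n \<Rightarrow> nat" where
  "l0norm v = card {i. v $ i \<noteq> 0}"

definition cube :: "(real ^ 'n) set" where
  "cube = {x. \<forall>i. x $ i \<in> {- 1, 1}}"

text \<open>Joint law of \<open>(x, y)\<close>. The second argument of \<^const>\<open>Pi_pmf\<close> is only the default value
  outside the index set and is irrelevant for the index set \<^const>\<open>UNIV\<close>.\<close>

definition bernoulli_mixture ::
    "real ^ 'n \<Rightarrow> real ^ 'n \<Rightarrow> real \<Rightarrow> ((real ^ 'n) \<times> int) pmf" where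
  "bernoulli_mixture \<theta>p \<theta>m t =
     bind_pmf (pmf_of_set {- 1, 1 :: int}) (\<lambda>y.
       let \<theta> = (if y = 1 then \<theta>p else \<theta>m) in
       map_pmf (\<lambda>f. (\<chi> i. f i, y))
         (Pi_pmf UNIV 0 (\<lambda>i.
            map_pmf (\<lambda>b. if b then \<theta> $ i else - (\<theta> $ i)) (bernoulli_pmf (1/2 + t)))))"

text \<open>Only the values of a classifier on the cube matter; outside it is unconstrained.\<close>

definition classifiers :: "(real ^ 'n \<Rightarrow> int) set" where
  "classifiers = {h. \<forall>x\<in>cube. h x \<in> {- 1, 1}}"

definition adv_error ::
    "nat \<Rightarrow> (real ^ 'n \<Rightarrow> int) \<Rightarrow> ((real ^ 'n) \<times> int) pmf \<Rightarrow> real" where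
  "adv_error \<epsilon> h D = measure_pmf.expectation D
     (\<lambda>(x, y). of_bool (\<exists>z\<in>cube. l0norm (z - x) \<le> \<epsilon> \<and> h z \<noteq> y))"

definition optimal_robust ::
    "nat \<Rightarrow> (real ^ 'n \<Rightarrow> int) \<Rightarrow> ((real ^ 'n) \<times> int) pmf \<Rightarrow> bool" where
  "optimal_robust \<epsilon> h D \<longleftrightarrow>
     h \<in> classifiers \<and> (\<forall>g\<in>classifiers. adv_error \<epsilon> h D \<le> adv_error \<epsilon> g D)"

definition optimal_rate :: "nat \<Rightarrow> ((real ^ 'n) \<times> int) pmf \<Rightarrow> real" where
  "optimal_rate \<epsilon> D = (INF h\<in>classifiers. adv_error \<epsilon> h D)"

text \<open>Restriction of \<open>x\<close> to the coordinates in which \<open>\<theta>p\<close> and \<open>\<theta>m\<close> differ. The dropped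
  coordinates are set to zero rather than removed, so that they do not contribute to
  \<^const>\<open>l0norm\<close>.\<close>

definition restrict_diff :: "real ^ 'n \<Rightarrow> real ^ 'n \<Rightarrow> real ^ 'n \<Rightarrow> real ^ 'n" where
  "restrict_diff \<theta>p \<theta>m x = (\<chi> i. if \<theta>p $ i \<noteq> \<theta>m $ i then x $ i else 0)"

end

(*
  Let the level of x be the number of coordinates where x disagrees with theta_p among the k
  coordinates where theta_p and theta_m differ. Given the label, it is binomial, and l0 perturbations
  of size eps reach exactly the levels at distance at most eps. A classifier depending only on the
  level is thus a set A of levels, and it is robustly correct on the eps-interior U of A given
  label 1, and on the eps-interior V of the complement given label -1. Distinct elements of U and V
  are more than 2 eps apart.

  For t < 1/2 all weights are positive, and the likelihood ratio favours label 1 below k/2 and label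
  -1 above. If some v in V lies below some u in U, then, up to reflection, relabelling everything up
  to u by 1 strictly increases the accuracy. Hence U lies below V, and comparing A with the threshold
  set just below V forces A to be that set.

  For t = 1/2 the law is supported on the two centres, and the optimum is far from unique: flipping
  an optimal classifier at a point outside the relevant balls keeps it optimal, which contradicts
  symmetry on every level with more than one point, in particular on every intermediate level.
*)
theory Submission
  imports Defs
begin

subsection \<open>Optimal sets of levels\<close>

text \<open>The levels from which no perturbation of size at most \<open>\<epsilon>\<close> leaves \<open>A\<close>.\<close>

definition core :: "nat \<Rightarrow> nat \<Rightarrow> nat set \<Rightarrow> nat set" where
  "core k \<epsilon> A = {m. m \<le> k \<and> (\<forall>j\<le>k. j \<le> m + \<epsilon> \<longrightarrow> m \<le> j + \<epsilon> \<longrightarrow> j \<in> A)}"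

text \<open>With \<open>w\<close> the binomial weights, this is twice the robust accuracy of the classifier with value
  \<open>1\<close> exactly on the levels in \<open>A\<close>: level \<open>m\<close> has probability \<open>w (k - m)\<close> given label \<open>1\<close> and \<open>w m\<close>
  given label \<open>- 1\<close>.\<close>

definition reward :: "(nat \<Rightarrow> real) \<Rightarrow> nat \<Rightarrow> nat \<Rightarrow> nat set \<Rightarrow> real" where
  "reward w k \<epsilon> A = (\<Sum>m\<in>core k \<epsilon> A. w (k - m)) + (\<Sum>m\<in>core k \<epsilon> (- A). w m)"

lemma coreI: "m \<le> k \<Longrightarrow> (\<And>j. \<lbrakk>j \<le> k; j \<le> m + \<epsilon>; m \<le> j + \<epsilon>\<rbrakk> \<Longrightarrow> j \<in> A) \<Longrightarrow> m \<in> core k \<epsilon> A"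
  by (simp add: core_def)

lemma coreD: "m \<in> core k \<epsilon> A \<Longrightarrow> j \<le> k \<Longrightarrow> j \<le> m + \<epsilon> \<Longrightarrow> m \<le> j + \<epsilon> \<Longrightarrow> j \<in> A"
  by (simp add: core_def)

lemma core_le: "m \<in> core k \<epsilon> A \<Longrightarrow> m \<le> k"
  by (simp add: core_def)

lemma core_subset: "core k \<epsilon> A \<subseteq> {..k}"
  by (auto simp: core_def)

lemma finite_core: "finite (core k \<epsilon> A)"
  by (rule finite_subset[OF core_subset]) simp

text \<open>Otherwise the windows of radius \<open>\<epsilon>\<close> about \<open>u\<close> and
  \<open>v\<close> share a level, namely \<open>v\<close> itself or \<open>u + \<epsilon>\<close>,
  which would lie both in \<open>A\<close> and outside it.\<close>

lemma core_separated:
  assumes "u \<in> core k \<epsilon> A" "v \<in> core k \<epsilon> (- A)" "u < v"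
  shows "u + 2 * \<epsilon> < v"
proof (rule ccontr)
  assume le: "\<not> u + 2 * \<epsilon> < v"
  have "v \<le> k" using assms(2) by (rule core_le)
  show False
  proof (cases "v \<le> u + \<epsilon>")
    case True
    then show ?thesis using coreD[OF assms(1), of v] coreD[OF assms(2), of v] \<open>v \<le> k\<close> assms(3) by simp
  next
    case False
    then show ?thesis
      using coreD[OF assms(1), of "u + \<epsilon>"] coreD[OF assms(2), of "u + \<epsilon>"] \<open>v \<le> k\<close> le by simp
  qed
qed

lemma core_disjoint: "core k \<epsilon> A \<inter> core k \<epsilon> (- A) = {}"
  by (auto simp: core_def)

text \<open>Exchanges the two centres and the two labels at once: the first reverses the order of
  the levels, the second complements the set.\<close>

definition reflect :: "nat \<Rightarrow> nat set \<Rightarrow> nat set" where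
  "reflect k A = {j. k - j \<notin> A}"

lemma mem_core_reflect:
  assumes "m \<le> k"
  shows "m \<in> core k \<epsilon> (reflect k A) \<longleftrightarrow> k - m \<in> core k \<epsilon> (- A)"
proof -
  have "(\<forall>j\<le>k. j \<le> m + \<epsilon> \<longrightarrow> m \<le> j + \<epsilon> \<longrightarrow> k - j \<notin> A) \<longleftrightarrow>
    (\<forall>j\<le>k. j \<le> k - m + \<epsilon> \<longrightarrow> k - m \<le> j + \<epsilon> \<longrightarrow> j \<notin> A)" (is "?l = ?r")
  proof
    assume l: ?l
    show ?r
    proof (intro allI impI)
      fix j assume "j \<le> k" "j \<le> k - m + \<epsilon>" "k - m \<le> j + \<epsilon>"
      then show "j \<notin> A" using l[rule_format, of "k - j"] assms by simp
    qed
  next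
    assume r: ?r
    show ?l
    proof (intro allI impI)
      fix j assume "j \<le> k" "j \<le> m + \<epsilon>" "m \<le> j + \<epsilon>"
      then show "k - j \<notin> A" using r[rule_format, of "k - j"] assms by simp
    qed
  qed
  then show ?thesis using assms by (simp add: core_def reflect_def)
qed

lemma mem_core_Compl_reflect:
  assumes "m \<le> k"
  shows "m \<in> core k \<epsilon> (- reflect k A) \<longleftrightarrow> k - m \<in> core k \<epsilon> A"
proof -
  have "- reflect k A = reflect k (- A)" by (auto simp: reflect_def)
  then show ?thesis using mem_core_reflect[OF assms, of \<epsilon> "- A"] by simp
qed

lemma reward_reflect: "reward w k \<epsilon> (reflect k A) = reward w k \<epsilon> A"
proof -
  have "(\<Sum>m\<in>core k \<epsilon> (reflect k A). w (k - m)) = (\<Sum>m\<in>core k \<epsilon> (- A). w m)"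
    by (rule sum.reindex_bij_witness[of _ "\<lambda>m. k - m" "\<lambda>m. k - m"])
      (metis core_le mem_core_reflect diff_diff_cancel diff_le_self)+
  moreover have "(\<Sum>m\<in>core k \<epsilon> (- reflect k A). w m) = (\<Sum>m\<in>core k \<epsilon> A. w (k - m))"
    by (rule sum.reindex_bij_witness[of _ "\<lambda>m. k - m" "\<lambda>m. k - m"])
      (metis core_le mem_core_Compl_reflect diff_diff_cancel diff_le_self)+
  ultimately show ?thesis by (simp add: reward_def)
qed

text \<open>Bounds the reward of a competing set from below without determining its cores
  exactly.\<close>

lemma reward_ge:
  assumes "\<And>i. i \<le> k \<Longrightarrow> 0 \<le> w i" "X \<subseteq> core k \<epsilon> A" "Y \<subseteq> core k \<epsilon> (- A)"
  shows "(\<Sum>m\<in>X. w (k - m)) + (\<Sum>m\<in>Y. w m) \<le> reward w k \<epsilon> A"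
  unfolding reward_def using assms core_subset[of k \<epsilon>]
  by (intro add_mono sum_mono2 finite_core) (auto simp: subset_iff)

text \<open>Replacing \<open>A\<close> by \<open>A \<union> {..u}\<close> moves the elements of the core of \<open>- A\<close> below \<open>u\<close> into the core of
  \<open>A\<close>, which does not lower their weight, and gains the gap above the last of them.\<close>

lemma maximal_core_ordered_left:
  assumes pos: "\<And>i. i \<le> k \<Longrightarrow> 0 < w i"
    and mono: "\<And>i. 2 * i \<le> k \<Longrightarrow> w i \<le> w (k - i)"
    and max: "\<And>B. reward w k \<epsilon> B \<le> reward w k \<epsilon> A"
    and "0 < \<epsilon>" and u: "u \<in> core k \<epsilon> A" and v: "v \<in> core k \<epsilon> (- A)" and "v < u"
    and left: "\<And>v'. v' \<in> core k \<epsilon> (- A) \<Longrightarrow> v' < u \<Longrightarrow> 2 * v' \<le> k"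
  shows False
proof -
  let ?U = "core k \<epsilon> A" and ?V = "core k \<epsilon> (- A)"
  define V1 where "V1 = {m \<in> ?V. m < u}"
  define V2 where "V2 = {m \<in> ?V. u < m}"
  have uk: "u \<le> k" using u core_subset by blast
  have fin: "finite V1" "finite V2" "finite ?U" using finite_core by (simp_all add: V1_def V2_def)
  \<comment> \<open>\<open>v0\<close> is the last level to be moved. Its successor still lies below
    \<open>u\<close> and belongs to neither core, so its weight is the strict gain.\<close>
  define v0 where "v0 = Max V1"
  have "v0 \<in> V1" unfolding v0_def using v \<open>v < u\<close> fin by (intro Max_in) (auto simp: V1_def)
  then have v0: "v0 \<in> ?V" "v0 < u" by (auto simp: V1_def)
  have sep: "v0 + 2 * \<epsilon> < u"
    using core_separated[of v0 k \<epsilon> "- A" u] v0 u by simp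
  have "Suc v0 \<notin> V1" using Max_ge[OF fin(1), of "Suc v0"] by (auto simp: v0_def)
  moreover have "Suc v0 \<notin> ?U"
    using core_separated[of v0 k \<epsilon> "- A" "Suc v0"] v0 \<open>0 < \<epsilon>\<close> by auto
  ultimately have new: "Suc v0 \<notin> ?U \<union> V1" by simp
  have disj: "?U \<inter> V1 = {}" "V1 \<inter> V2 = {}" "?U \<inter> ?V = {}"
    using core_disjoint by (auto simp: V1_def V2_def)
  have V: "?V = V1 \<union> V2"
    using disj(3) u unfolding V1_def V2_def by (auto simp: neq_iff)
  have "reward w k \<epsilon> A = (\<Sum>m\<in>?U. w (k - m)) + ((\<Sum>m\<in>V1. w m) + (\<Sum>m\<in>V2. w m))"
    unfolding reward_def V using fin disj by (simp add: sum.union_disjoint)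
  \<comment> \<open>\<open>left\<close> puts \<open>V1\<close> in the lower half of the levels,
    where label 1 carries at least as much weight.\<close>
  also have "(\<Sum>m\<in>V1. w m) \<le> (\<Sum>m\<in>V1. w (k - m))"
    using left by (intro sum_mono mono) (auto simp: V1_def)
  also have "(\<Sum>m\<in>?U. w (k - m)) + ((\<Sum>m\<in>V1. w (k - m)) + (\<Sum>m\<in>V2. w m))
      < (\<Sum>m\<in>insert (Suc v0) (?U \<union> V1). w (k - m)) + (\<Sum>m\<in>V2. w m)"
    using new fin disj pos[of "k - Suc v0"] by (simp add: sum.union_disjoint)
  also have "\<dots> \<le> reward w k \<epsilon> (A \<union> {..u})"
  proof (rule reward_ge)
    show "insert (Suc v0) (?U \<union> V1) \<subseteq> core k \<epsilon> (A \<union> {..u})"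
    proof
      fix m assume "m \<in> insert (Suc v0) (?U \<union> V1)"
      then consider "m \<in> ?U" | "m < u" using v0 sep \<open>0 < \<epsilon>\<close> by (auto simp: V1_def)
      then show "m \<in> core k \<epsilon> (A \<union> {..u})"
      proof cases
        case 1 then show ?thesis by (auto simp: core_def)
      next
        case 2
        show ?thesis
        \<comment> \<open>A level of this window that exceeds \<open>u\<close> is within
          \<open>\<epsilon>\<close> of \<open>u\<close>, hence in \<open>A\<close>.\<close>
        proof (rule coreI)
          fix j assume j: "j \<le> k" "j \<le> m + \<epsilon>"
          show "j \<in> A \<union> {..u}"
            using coreD[OF u j(1)] j 2 by (cases "j \<le> u") auto
        qed (use 2 uk in simp)
      qed
    qed
    show "V2 \<subseteq> core k \<epsilon> (- (A \<union> {..u}))"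
    proof
      fix m assume m: "m \<in> V2"
      then have "u + 2 * \<epsilon> < m" using core_separated[OF u] by (auto simp: V2_def)
      then show "m \<in> core k \<epsilon> (- (A \<union> {..u}))"
        using m by (auto simp: V2_def core_def)
    qed
  qed (use pos less_imp_le in blast)
  finally show False using max[of "A \<union> {..u}"] by simp
qed

text \<open>If some \<open>v\<close> lay below \<open>u\<close>, take the last such level
  \<open>v0\<close>. When \<open>v0\<close> is in the lower half, so are all earlier ones, and
  relabelling up to \<open>u\<close> contradicts maximality. Otherwise the same argument applies to
  the reflected set, with \<open>k - v0\<close> in the role of \<open>u\<close>.\<close>

lemma maximal_core_ordered:
  assumes pos: "\<And>i. i \<le> k \<Longrightarrow> 0 < w i"
    and mono: "\<And>i. 2 * i \<le> k \<Longrightarrow> w i \<le> w (k - i)"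
    and max: "\<And>B. reward w k \<epsilon> B \<le> reward w k \<epsilon> A"
    and "0 < \<epsilon>" and u: "u \<in> core k \<epsilon> A" and v: "v \<in> core k \<epsilon> (- A)"
  shows "u < v"
proof (rule ccontr)
  assume "\<not> u < v"
  moreover have "u \<noteq> v" using u v core_disjoint by blast
  ultimately have "v < u" by simp
  have uk: "u \<le> k" "v \<le> k" using u v core_subset by blast+
  define v0 where "v0 = Max {m \<in> core k \<epsilon> (- A). m < u}"
  have "v0 \<in> {m \<in> core k \<epsilon> (- A). m < u}"
    unfolding v0_def using v \<open>v < u\<close> finite_core by (intro Max_in) auto
  then have v0: "v0 \<in> core k \<epsilon> (- A)" "v0 < u" by auto
  show False
  proof (cases "2 * v0 \<le> k")
    case True
    have "2 * v' \<le> k" if "v' \<in> core k \<epsilon> (- A)" "v' < u" for v'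
    proof -
      have "v' \<le> v0" unfolding v0_def using that finite_core by (intro Max_ge) auto
      then show ?thesis using True by simp
    qed
    then show False
      using maximal_core_ordered_left[OF pos mono max \<open>0 < \<epsilon>\<close> u v \<open>v < u\<close>] by blast
  next
    case False
    show False
    proof (rule maximal_core_ordered_left[of k w \<epsilon> "reflect k A" "k - v0" "k - u"])
      show "reward w k \<epsilon> B \<le> reward w k \<epsilon> (reflect k A)" for B
        using max by (simp add: reward_reflect)
      show "k - v0 \<in> core k \<epsilon> (reflect k A)"
        using v0 uk by (simp add: mem_core_reflect)
      show "k - u \<in> core k \<epsilon> (- reflect k A)"
        using u uk by (simp add: mem_core_Compl_reflect)
      show "2 * v' \<le> k" if "v' \<in> core k \<epsilon> (- reflect k A)" "v' < k - v0" for v'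
        using that False by simp
    qed (use pos mono \<open>0 < \<epsilon>\<close> v0 uk in auto)
  qed
qed

lemma core_UNIV: "core k \<epsilon> UNIV = {..k}" "core k \<epsilon> {} = {}"
  by (auto simp: core_def)

text \<open>An empty core would make a constant labelling strictly better, so both cores are
  nonempty. Separation then confines them to an initial and a final segment of levels. A threshold
  set fills both segments, so by positivity of the weights the cores of \<open>A\<close> fill them
  too, and these determine \<open>A\<close>.\<close>

lemma threshold_if_maximal_reward:
  assumes pos: "\<And>i. i \<le> k \<Longrightarrow> 0 < w i"
    and mono: "\<And>i. 2 * i \<le> k \<Longrightarrow> w i \<le> w (k - i)"
    and max: "\<And>B. reward w k \<epsilon> B \<le> reward w k \<epsilon> A"
    and "0 < \<epsilon>" and a: "a \<in> A" "a \<le> k" and b: "b \<notin> A" "b \<le> k"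
  shows "\<exists>s<k. \<forall>j\<le>k. j \<in> A \<longleftrightarrow> j \<le> s"
proof -
  let ?U = "core k \<epsilon> A" and ?V = "core k \<epsilon> (- A)"
  have strict: "sum f X < sum f Y"
    if "X \<subseteq> Y" "x \<in> Y" "x \<notin> X" "finite Y" "\<And>y. y \<in> Y \<Longrightarrow> 0 < f y" for X Y x and f :: "nat \<Rightarrow> real"
    using that by (intro sum_strict_mono2) (auto intro: less_imp_le)
  have "?V \<noteq> {}"
  proof
    assume "?V = {}"
    moreover have "b \<notin> ?U" using b by (auto simp: core_def)
    then have "(\<Sum>m\<in>?U. w (k - m)) < (\<Sum>m\<le>k. w (k - m))"
      using core_subset b pos by (intro strict[of _ _ b]) auto
    ultimately show False using max[of UNIV] by (simp add: reward_def core_UNIV)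
  qed
  have "?U \<noteq> {}"
  proof
    assume "?U = {}"
    moreover have "a \<notin> ?V" using a by (auto simp: core_def)
    then have "(\<Sum>m\<in>?V. w m) < (\<Sum>m\<le>k. w m)"
      using core_subset a pos by (intro strict[of _ _ a]) auto
    ultimately show False using max[of "{}"] by (simp add: reward_def core_UNIV)
  qed
  then obtain u0 where u0: "u0 \<in> ?U" by auto
  define v where "v = Min ?V"
  have v: "v \<in> ?V" unfolding v_def using \<open>?V \<noteq> {}\<close> finite_core by (intro Min_in)
  then have "v \<le> k" using core_subset by blast
  have Vsub: "?V \<subseteq> {v..k}"
    using core_subset[of k \<epsilon> "- A"] Min_le[OF finite_core[of k \<epsilon> "- A"]] by (auto simp: v_def)
  have sep: "u + 2 * \<epsilon> < v" if "u \<in> ?U" for u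
    using core_separated[OF that v] maximal_core_ordered[OF pos mono max \<open>0 < \<epsilon>\<close> that v] by simp
  then have Usub: "?U \<subseteq> {..v - 2 * \<epsilon> - 1}" by fastforce
  have "2 * \<epsilon> < v" using sep[OF u0] by simp
  \<comment> \<open>The window of \<open>v\<close> starts at \<open>v - \<epsilon>\<close>, so this
    is the largest initial segment avoiding it. Its own core ends \<open>\<epsilon>\<close> levels
    earlier. As \<open>2 * \<epsilon> < v\<close>, no subtraction is truncated.\<close>
  let ?B = "{..v - \<epsilon> - 1}"
  have "(\<Sum>m\<in>{..v - 2 * \<epsilon> - 1}. w (k - m)) + (\<Sum>m\<in>{v..k}. w m) \<le> reward w k \<epsilon> ?B"
    using \<open>2 * \<epsilon> < v\<close> \<open>v \<le> k\<close> pos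
    by (intro reward_ge) (auto simp: core_def intro: less_imp_le)
  also have "\<dots> \<le> reward w k \<epsilon> A" by (rule max)
  finally have le: "(\<Sum>m\<in>{..v - 2 * \<epsilon> - 1}. w (k - m)) + (\<Sum>m\<in>{v..k}. w m)
      \<le> (\<Sum>m\<in>?U. w (k - m)) + (\<Sum>m\<in>?V. w m)" by (simp add: reward_def)
  have leU: "(\<Sum>m\<in>?U. w (k - m)) \<le> (\<Sum>m\<in>{..v - 2 * \<epsilon> - 1}. w (k - m))"
    using Usub pos by (intro sum_mono2) (auto intro: less_imp_le)
  have leV: "(\<Sum>m\<in>?V. w m) \<le> (\<Sum>m\<in>{v..k}. w m)"
    using Vsub pos by (intro sum_mono2) (auto intro: less_imp_le)
  have U: "?U = {..v - 2 * \<epsilon> - 1}"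
  proof (rule ccontr)
    assume "\<not> ?thesis"
    then obtain x where "x \<in> {..v - 2 * \<epsilon> - 1}" "x \<notin> ?U" using Usub by blast
    then have "(\<Sum>m\<in>?U. w (k - m)) < (\<Sum>m\<in>{..v - 2 * \<epsilon> - 1}. w (k - m))"
      using Usub pos by (intro strict[of _ _ x]) auto
    then show False using le leV by simp
  qed
  have V: "?V = {v..k}"
  proof (rule ccontr)
    assume "\<not> ?thesis"
    then obtain x where "x \<in> {v..k}" "x \<notin> ?V" using Vsub by blast
    then have "(\<Sum>m\<in>?V. w m) < (\<Sum>m\<in>{v..k}. w m)"
      using Vsub pos by (intro strict[of _ _ x]) auto
    then show False using le leU by simp
  qed
  have "j \<in> A \<longleftrightarrow> j \<le> v - \<epsilon> - 1" if "j \<le> k" for j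
  proof (cases "j \<le> v - \<epsilon> - 1")
    case True
    \<comment> \<open>This is the element of \<open>?U\<close> nearest to \<open>j\<close>, at
      distance at most \<open>\<epsilon>\<close>; in the other case \<open>max j v\<close> plays
      this role for \<open>?V\<close>.\<close>
    then have "min j (v - 2 * \<epsilon> - 1) \<in> ?U" unfolding U by simp
    from coreD[OF this that] True \<open>2 * \<epsilon> < v\<close> show ?thesis by (auto simp: min_def)
  next
    case False
    then have "max j v \<in> ?V" unfolding V using that \<open>v \<le> k\<close> by simp
    from coreD[OF this that] False \<open>2 * \<epsilon> < v\<close> show ?thesis
      by (cases "j \<le> v") (auto simp: max_absorb1 max_absorb2)
  qed
  moreover have "v - \<epsilon> - 1 < k" using \<open>v \<le> k\<close> \<open>2 * \<epsilon> < v\<close> by simp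
  ultimately show ?thesis by blast
qed

subsection \<open>Levels of the cube\<close>

definition level :: "real ^ 'n \<Rightarrow> real ^ 'n \<Rightarrow> real ^ 'n \<Rightarrow> nat" where
  "level \<theta>p \<theta>m x = l0norm (restrict_diff \<theta>p \<theta>m x - restrict_diff \<theta>p \<theta>m \<theta>p)"

lemma l0norm_diff: "l0norm (x - y) = card {i. x $ i \<noteq> y $ i}"
  by (simp add: l0norm_def)

lemma level_eq_card: "level \<theta>p \<theta>m x = card {i. \<theta>p $ i \<noteq> \<theta>m $ i \<and> x $ i \<noteq> \<theta>p $ i}"
  unfolding level_def l0norm_diff by (rule arg_cong[of _ _ card]) (auto simp: restrict_diff_def)

lemma level_le: "level \<theta>p \<theta>m x \<le> l0norm (\<theta>p - \<theta>m)"
  unfolding level_eq_card l0norm_diff by (rule card_mono) auto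

lemma level_left: "level \<theta>p \<theta>m \<theta>p = 0"
  by (simp add: level_eq_card)

lemma level_right: "level \<theta>p \<theta>m \<theta>m = l0norm (\<theta>p - \<theta>m)"
  unfolding level_eq_card l0norm_diff by (rule arg_cong[of _ _ card]) auto

lemma cube_component: "x \<in> cube \<Longrightarrow> x $ i = 1 \<or> x $ i = - 1"
  by (auto simp: cube_def)

lemma cube_eq_iff:
  assumes "x \<in> cube" "y \<in> cube" "z \<in> cube" "x $ i \<noteq> y $ i"
  shows "z $ i \<noteq> x $ i \<longleftrightarrow> z $ i = y $ i"
  using assms(4) cube_component[OF assms(1), of i] cube_component[OF assms(2), of i]
    cube_component[OF assms(3), of i] by auto

text \<open>Where the centres differ, a point of the cube agrees with exactly one of them.\<close>

lemma level_swap: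
  assumes "\<theta>p \<in> cube" "\<theta>m \<in> cube" "x \<in> cube"
  shows "level \<theta>m \<theta>p x = l0norm (\<theta>p - \<theta>m) - level \<theta>p \<theta>m x"
proof -
  have "{i. \<theta>m $ i \<noteq> \<theta>p $ i \<and> x $ i \<noteq> \<theta>m $ i}
      = {i. \<theta>p $ i \<noteq> \<theta>m $ i} - {i. \<theta>p $ i \<noteq> \<theta>m $ i \<and> x $ i \<noteq> \<theta>p $ i}"
    using cube_eq_iff[OF assms] by auto
  then show ?thesis unfolding level_eq_card l0norm_diff by (simp add: card_Diff_subset subset_iff)
qed

lemma l0norm_minus_commute: "l0norm (x - y) = l0norm (y - x)"
  unfolding l0norm_diff by (rule arg_cong[of _ _ card]) auto

lemma level_le_add: "level \<theta>p \<theta>m x \<le> level \<theta>p \<theta>m z + l0norm (z - x)"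
proof -
  have "level \<theta>p \<theta>m x \<le> card ({i. \<theta>p $ i \<noteq> \<theta>m $ i \<and> z $ i \<noteq> \<theta>p $ i} \<union> {i. z $ i \<noteq> x $ i})"
    unfolding level_eq_card by (rule card_mono) auto
  also have "\<dots> \<le> level \<theta>p \<theta>m z + l0norm (z - x)"
    unfolding level_eq_card l0norm_diff by (rule card_Un_le)
  finally show ?thesis .
qed

section \<open>Moving between levels by sign flips\<close>

definition flip :: "'n set \<Rightarrow> real ^ 'n \<Rightarrow> real ^ 'n" where
  "flip T x = (\<chi> i. if i \<in> T then - x $ i else x $ i)"

lemma flip_cube: "x \<in> cube \<Longrightarrow> flip T x \<in> cube"
  by (auto simp: flip_def cube_def)

lemma cube_nonzero: "x \<in> cube \<Longrightarrow> x $ i \<noteq> 0"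
  using cube_component[of x i] by auto

lemma cube_uminus_iff: "x \<in> cube \<Longrightarrow> y \<in> cube \<Longrightarrow> - x $ i \<noteq> y $ i \<longleftrightarrow> x $ i = y $ i"
  using cube_component[of x i] cube_component[of y i] by auto

lemma l0norm_flip: "x \<in> cube \<Longrightarrow> l0norm (flip T x - x) = card T"
  unfolding l0norm_diff flip_def
  by (rule arg_cong[of _ _ card]) (auto simp: cube_nonzero)

lemma level_flip:
  fixes x \<theta>p \<theta>m :: "real ^ 'n"
  assumes "x \<in> cube" "\<theta>p \<in> cube"
  defines "F \<equiv> {i. \<theta>p $ i \<noteq> \<theta>m $ i \<and> x $ i \<noteq> \<theta>p $ i}"
    and "E \<equiv> {i. \<theta>p $ i \<noteq> \<theta>m $ i \<and> x $ i = \<theta>p $ i}"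
  shows "level \<theta>p \<theta>m (flip T x) = card ((F - T) \<union> (E \<inter> T))"
  unfolding level_eq_card F_def E_def flip_def
  by (rule arg_cong[of _ _ card]) (auto simp: cube_uminus_iff[OF assms(1,2)])

text \<open>Flip agreeing coordinates to raise the level and disagreeing ones to lower it. One of
  the two truncated differences is 0, so their sum is the distance between the levels.\<close>

lemma exists_level:
  assumes "x \<in> cube" "\<theta>p \<in> cube" "j \<le> l0norm (\<theta>p - \<theta>m)"
  obtains z where "z \<in> cube" "level \<theta>p \<theta>m z = j"
    "l0norm (z - x) = (j - level \<theta>p \<theta>m x) + (level \<theta>p \<theta>m x - j)"
proof -
  let ?F = "{i. \<theta>p $ i \<noteq> \<theta>m $ i \<and> x $ i \<noteq> \<theta>p $ i}"
  let ?E = "{i. \<theta>p $ i \<noteq> \<theta>m $ i \<and> x $ i = \<theta>p $ i}"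
  have "{i. \<theta>p $ i \<noteq> \<theta>m $ i} = ?F \<union> ?E" by auto
  then have k: "l0norm (\<theta>p - \<theta>m) = card ?F + card ?E"
    unfolding l0norm_diff by (simp, subst card_Un_disjoint) auto
  have F: "level \<theta>p \<theta>m x = card ?F" by (simp add: level_eq_card)
  show thesis
  proof (cases "card ?F \<le> j")
    case True
    have "j - card ?F \<le> card ?E" using k assms(3) by simp
    then obtain T where T: "T \<subseteq> ?E" "card T = j - card ?F"
      by (rule obtain_subset_with_card_n)
    have "level \<theta>p \<theta>m (flip T x) = card (?F \<union> T)"
      unfolding level_flip[OF assms(1,2)] using T by (intro arg_cong[of _ _ card]) auto
    also have "\<dots> = card ?F + card T" using T by (intro card_Un_disjoint) auto
    finally show thesis
      using that[of "flip T x"] T True F flip_cube[OF assms(1)] l0norm_flip[OF assms(1)] by simp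
  next
    case False
    obtain T where T: "T \<subseteq> ?F" "card T = card ?F - j"
      using diff_le_self by (rule obtain_subset_with_card_n)
    have "level \<theta>p \<theta>m (flip T x) = card (?F - T)"
      unfolding level_flip[OF assms(1,2)] using T by (intro arg_cong[of _ _ card]) auto
    also have "\<dots> = card ?F - card T" using T by (intro card_Diff_subset) auto
    finally show thesis
      using that[of "flip T x"] T False F flip_cube[OF assms(1)] l0norm_flip[OF assms(1)] by simp
  qed
qed

text \<open>Strictly between the extreme levels there are both a disagreeing and an agreeing
  coordinate; flipping one of each preserves the count.\<close>

lemma exists_other_same_level:
  assumes "x \<in> cube" "\<theta>p \<in> cube" "0 < level \<theta>p \<theta>m x" "level \<theta>p \<theta>m x < l0norm (\<theta>p - \<theta>m)"
  obtains y where "y \<in> cube" "y \<noteq> x" "level \<theta>p \<theta>m y = level \<theta>p \<theta>m x"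
proof -
  let ?F = "{i. \<theta>p $ i \<noteq> \<theta>m $ i \<and> x $ i \<noteq> \<theta>p $ i}"
  have lev: "level \<theta>p \<theta>m x = card ?F" by (simp add: level_eq_card)
  then have "?F \<noteq> {}" using assms(3) by (metis card.empty less_irrefl)
  then obtain a where a: "a \<in> ?F" by blast
  have "?F \<noteq> {i. \<theta>p $ i \<noteq> \<theta>m $ i}" using assms(4) unfolding lev l0norm_diff by auto
  then obtain b where b: "\<theta>p $ b \<noteq> \<theta>m $ b" "x $ b = \<theta>p $ b" by blast
  have "level \<theta>p \<theta>m (flip {a, b} x) = card (insert b (?F - {a}))"
    unfolding level_flip[OF assms(1,2)] using a b by (intro arg_cong[of _ _ card]) auto
  also have "\<dots> = Suc (card (?F - {a}))" using b by (intro card_insert_disjoint) auto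
  also have "\<dots> = card ?F" using a by (intro card_Suc_Diff1) auto
  finally have "level \<theta>p \<theta>m (flip {a, b} x) = level \<theta>p \<theta>m x" unfolding lev .
  moreover have "flip {a, b} x \<noteq> x"
    using cube_nonzero[OF assms(1), of a] by (auto simp: flip_def vec_eq_iff)
  ultimately show thesis using that flip_cube[OF assms(1)] by blast
qed

text \<open>Perturbations of size \<open>\<epsilon>\<close> reach exactly the levels at distance at
  most \<open>\<epsilon>\<close>: \<open>level_le_add\<close> shows that no others are reached,
  \<open>exists_level\<close> that all of these are.\<close>

lemma near_level_iff_core:
  assumes "x \<in> cube" "\<theta>p \<in> cube"
  shows "(\<exists>z\<in>cube. l0norm (z - x) \<le> \<epsilon> \<and> level \<theta>p \<theta>m z \<notin> A)
    \<longleftrightarrow> level \<theta>p \<theta>m x \<notin> core (l0norm (\<theta>p - \<theta>m)) \<epsilon> A"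
proof
  assume "\<exists>z\<in>cube. l0norm (z - x) \<le> \<epsilon> \<and> level \<theta>p \<theta>m z \<notin> A"
  then obtain z where z: "l0norm (z - x) \<le> \<epsilon>" "level \<theta>p \<theta>m z \<notin> A" by blast
  have "level \<theta>p \<theta>m z \<le> level \<theta>p \<theta>m x + \<epsilon>" "level \<theta>p \<theta>m x \<le> level \<theta>p \<theta>m z + \<epsilon>"
    using z(1) level_le_add[of \<theta>p \<theta>m x z] level_le_add[of \<theta>p \<theta>m z x]
      l0norm_minus_commute[of x z] by linarith+
  then show "level \<theta>p \<theta>m x \<notin> core (l0norm (\<theta>p - \<theta>m)) \<epsilon> A"
    using coreD[OF _ level_le] z(2) by blast
next
  assume "level \<theta>p \<theta>m x \<notin> core (l0norm (\<theta>p - \<theta>m)) \<epsilon> A"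
  then obtain j where j: "j \<le> l0norm (\<theta>p - \<theta>m)" "j \<le> level \<theta>p \<theta>m x + \<epsilon>"
      "level \<theta>p \<theta>m x \<le> j + \<epsilon>" "j \<notin> A"
    using level_le[of \<theta>p \<theta>m x] by (auto simp: core_def)
  obtain z where "z \<in> cube" "level \<theta>p \<theta>m z = j"
    "l0norm (z - x) = (j - level \<theta>p \<theta>m x) + (level \<theta>p \<theta>m x - j)"
    using exists_level[OF assms j(1)] .
  then show "\<exists>z\<in>cube. l0norm (z - x) \<le> \<epsilon> \<and> level \<theta>p \<theta>m z \<notin> A"
    using j by (intro bexI[of _ z]) auto
qed

subsection \<open>The adversarial error of level classifiers\<close>

text \<open>The law of \<open>x\<close> given its label, driven by independent coins that tell which
  coordinates are kept. This form connects it to \<open>binomial_pmf\<close>.\<close>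

definition noisy_copy :: "real ^ 'n \<Rightarrow> real \<Rightarrow> (real ^ 'n) pmf" where
  "noisy_copy \<theta> t = map_pmf (\<lambda>f. \<chi> i. if f i then \<theta> $ i else - (\<theta> $ i))
     (Pi_pmf UNIV False (\<lambda>_. bernoulli_pmf (1/2 + t)))"

lemma map_Pi_bernoulli:
  "map_pmf (\<lambda>f. (\<chi> i. f i, y))
     (Pi_pmf UNIV 0 (\<lambda>i. map_pmf (\<lambda>b. if b then \<theta> $ i else - (\<theta> $ i)) (bernoulli_pmf (1/2 + t))))
   = map_pmf (\<lambda>x. (x, y)) (noisy_copy \<theta> t)"
proof -
  have "Pi_pmf UNIV 0 (\<lambda>i. map_pmf (\<lambda>b. if b then \<theta> $ i else - (\<theta> $ i)) (bernoulli_pmf (1/2 + t)))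
    = map_pmf (\<lambda>f i. if f i then \<theta> $ i else - (\<theta> $ i))
        (Pi_pmf UNIV False (\<lambda>_. bernoulli_pmf (1/2 + t)))"
    unfolding map_pmf_def by (subst Pi_pmf_bind[where d' = False]) auto
  then show ?thesis by (simp add: noisy_copy_def pmf.map_comp o_def)
qed

lemma finite_set_pmf_noisy_copy: "finite (set_pmf (noisy_copy \<theta> t))"
  by (simp add: noisy_copy_def)

lemma set_pmf_noisy_copy: "\<theta> \<in> cube \<Longrightarrow> set_pmf (noisy_copy \<theta> t) \<subseteq> cube"
  by (auto simp: noisy_copy_def cube_def) (metis add.inverse_inverse)+

lemma adv_error_bernoulli_mixture:
  "adv_error \<epsilon> h (bernoulli_mixture \<theta>p \<theta>m t) =
    (measure_pmf.prob (noisy_copy \<theta>p t) {x. \<exists>z\<in>cube. l0norm (z - x) \<le> \<epsilon> \<and> h z \<noteq> 1} +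
     measure_pmf.prob (noisy_copy \<theta>m t) {x. \<exists>z\<in>cube. l0norm (z - x) \<le> \<epsilon> \<and> h z \<noteq> - 1}) / 2"
proof -
  have *: "measure_pmf.expectation p (\<lambda>x. of_bool (P x)) = measure_pmf.prob p {x. P x}"
    for p :: "(real ^ 'n) pmf" and P
  proof -
    have "measure_pmf.expectation p (\<lambda>x. of_bool (P x)) = measure_pmf.expectation p (indicator {x. P x})"
      by (rule Bochner_Integration.integral_cong) (auto simp: indicator_def)
    also have "\<dots> = measure_pmf.prob p {x. P x}" by (simp add: Bochner_Integration.integral_indicator)
    finally show ?thesis .
  qed
  show ?thesis
    unfolding adv_error_def bernoulli_mixture_def Let_def map_Pi_bernoulli
    by (subst pmf_expectation_bind_pmf_of_set)
      (simp_all add: finite_set_pmf_noisy_copy * field_simps)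
qed

text \<open>Where the centres differ, keeping the entry of \<open>\<theta>m\<close> means
  disagreeing with \<open>\<theta>p\<close>, so the level counts successful coins.\<close>

lemma map_level_noisy_copy_right:
  assumes "\<theta>p \<in> cube" "\<theta>m \<in> cube" "1/2 + t \<in> {0..1}"
  shows "map_pmf (level \<theta>p \<theta>m) (noisy_copy \<theta>m t) = binomial_pmf (l0norm (\<theta>p - \<theta>m)) (1/2 + t)"
proof -
  let ?S = "{i. \<theta>p $ i \<noteq> \<theta>m $ i}" and ?B = "\<lambda>_. bernoulli_pmf (1/2 + t)"
  have lev: "level \<theta>p \<theta>m (\<chi> i. if f i then \<theta>m $ i else - (\<theta>m $ i)) = card {i \<in> ?S. f i}" for f
  proof -
    have "{i. \<theta>p $ i \<noteq> \<theta>m $ i \<and> (if f i then \<theta>m $ i else - (\<theta>m $ i)) \<noteq> \<theta>p $ i} = {i \<in> ?S. f i}"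
      using cube_uminus_iff[OF assms(2,1)] by auto
    then show ?thesis by (simp add: level_eq_card)
  qed
  have "binomial_pmf (card ?S) (1/2 + t) = map_pmf (\<lambda>f. card {i \<in> ?S. f i}) (Pi_pmf ?S False ?B)"
    using assms(3) by (intro binomial_pmf_altdef') auto
  \<comment> \<open>Adds coins on the remaining coordinates, which the count ignores.\<close>
  also have "Pi_pmf ?S False ?B = map_pmf (\<lambda>f i. if i \<in> ?S then f i else False) (Pi_pmf UNIV False ?B)"
    by (rule Pi_pmf_subset) auto
  finally show ?thesis
    by (simp add: noisy_copy_def pmf.map_comp o_def lev l0norm_diff cong: conj_cong)
qed

lemma map_level_noisy_copy_left:
  fixes \<theta>p \<theta>m :: "real ^ 'n"
  assumes "\<theta>p \<in> cube" "\<theta>m \<in> cube" "1/2 + t \<in> {0..1}"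
  defines "k \<equiv> l0norm (\<theta>p - \<theta>m)"
  shows "map_pmf (\<lambda>x. k - level \<theta>p \<theta>m x) (noisy_copy \<theta>p t) = binomial_pmf k (1/2 + t)"
proof -
  have "map_pmf (\<lambda>x. k - level \<theta>p \<theta>m x) (noisy_copy \<theta>p t)
      = map_pmf (level \<theta>m \<theta>p) (noisy_copy \<theta>p t)"
    using set_pmf_noisy_copy[OF assms(1), of t] level_swap[OF assms(1,2)]
    by (intro map_pmf_cong) (auto simp: k_def subset_iff)
  then show ?thesis
    using map_level_noisy_copy_right[OF assms(2,1,3)] by (simp add: k_def l0norm_minus_commute)
qed

text \<open>Given label 1 an error means that the level is outside the core of \<open>A\<close>,
  given label -1 that it is outside the core of \<open>- A\<close>. Both probabilities are binomial
  and are averaged over the two labels.\<close>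

lemma adv_error_level_classifier:
  fixes \<theta>p \<theta>m :: "real ^ 'n"
  assumes cube: "\<theta>p \<in> cube" "\<theta>m \<in> cube" and t: "1/2 + t \<in> {0..1}"
    and h: "\<And>x. x \<in> cube \<Longrightarrow> h x = (if level \<theta>p \<theta>m x \<in> A then 1 else - 1)"
  defines "k \<equiv> l0norm (\<theta>p - \<theta>m)"
  shows "adv_error \<epsilon> h (bernoulli_mixture \<theta>p \<theta>m t)
    = 1 - reward (pmf (binomial_pmf k (1/2 + t))) k \<epsilon> A / 2"
proof -
  let ?N = "\<lambda>\<theta>. noisy_copy \<theta> t" and ?b = "binomial_pmf k (1/2 + t)"
  have prob_Compl: "measure_pmf.prob ?b (- X) = 1 - (\<Sum>m\<in>X. pmf ?b m)" if "finite X" for X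
    using measure_pmf.prob_compl[of X ?b] that
    by (simp add: Compl_eq_Diff_UNIV measure_measure_pmf_finite)
  have near: "(\<exists>z\<in>cube. l0norm (z - x) \<le> \<epsilon> \<and> h z \<noteq> 1) \<longleftrightarrow> level \<theta>p \<theta>m x \<notin> core k \<epsilon> A"
    "(\<exists>z\<in>cube. l0norm (z - x) \<le> \<epsilon> \<and> h z \<noteq> - 1) \<longleftrightarrow> level \<theta>p \<theta>m x \<notin> core k \<epsilon> (- A)"
    if "x \<in> cube" for x
    using near_level_iff_core[OF that cube(1), of \<epsilon> \<theta>m A]
      near_level_iff_core[OF that cube(1), of \<epsilon> \<theta>m "- A"]
    by (auto simp: k_def h split: if_splits)
  \<comment> \<open>Given label 1 it is \<open>k - level\<close> that is binomial, so the core
    enters through its image under \<open>m \<mapsto> k - m\<close>.\<close>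
  have "measure_pmf.prob (?N \<theta>p) {x. \<exists>z\<in>cube. l0norm (z - x) \<le> \<epsilon> \<and> h z \<noteq> 1}
      = measure_pmf.prob (?N \<theta>p) ((\<lambda>x. k - level \<theta>p \<theta>m x) -` (- (\<lambda>m. k - m) ` core k \<epsilon> A))"
  proof (rule measure_pmf.finite_measure_eq_AE, rule AE_pmfI)
    fix x assume "x \<in> set_pmf (?N \<theta>p)"
    then have x: "x \<in> cube" using set_pmf_noisy_copy[OF cube(1)] by blast
    have "k - level \<theta>p \<theta>m x \<in> (\<lambda>m. k - m) ` core k \<epsilon> A \<longleftrightarrow> level \<theta>p \<theta>m x \<in> core k \<epsilon> A"
      by (subst inj_on_image_mem_iff[where B = "{..k}"])
        (auto simp: inj_on_def k_def level_le dest: core_le)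
    then show "x \<in> {x. \<exists>z\<in>cube. l0norm (z - x) \<le> \<epsilon> \<and> h z \<noteq> 1} \<longleftrightarrow>
        x \<in> (\<lambda>x. k - level \<theta>p \<theta>m x) -` (- (\<lambda>m. k - m) ` core k \<epsilon> A)"
      using near(1)[OF x] by simp
  qed auto
  also have "\<dots> = measure_pmf.prob ?b (- (\<lambda>m. k - m) ` core k \<epsilon> A)"
    using map_level_noisy_copy_left[OF cube t, folded k_def] by (simp flip: measure_map_pmf)
  also have "\<dots> = 1 - (\<Sum>m\<in>core k \<epsilon> A. pmf ?b (k - m))"
  proof -
    have "inj_on (\<lambda>m. k - m) (core k \<epsilon> A)" by (auto simp: inj_on_def dest!: core_le)
    then show ?thesis by (simp add: prob_Compl finite_core sum.reindex)
  qed
  finally have left: "measure_pmf.prob (?N \<theta>p) {x. \<exists>z\<in>cube. l0norm (z - x) \<le> \<epsilon> \<and> h z \<noteq> 1} = \<dots>" .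
  have "measure_pmf.prob (?N \<theta>m) {x. \<exists>z\<in>cube. l0norm (z - x) \<le> \<epsilon> \<and> h z \<noteq> - 1}
      = measure_pmf.prob (?N \<theta>m) (level \<theta>p \<theta>m -` (- core k \<epsilon> (- A)))"
    using set_pmf_noisy_copy[OF cube(2), of t] near(2)
    by (intro measure_pmf.finite_measure_eq_AE AE_pmfI) (auto simp: subset_iff)
  also have "\<dots> = measure_pmf.prob ?b (- core k \<epsilon> (- A))"
    using map_level_noisy_copy_right[OF cube t, folded k_def] by (simp flip: measure_map_pmf)
  also have "\<dots> = 1 - (\<Sum>m\<in>core k \<epsilon> (- A). pmf ?b m)"
    by (simp add: prob_Compl finite_core)
  finally have right:
    "measure_pmf.prob (?N \<theta>m) {x. \<exists>z\<in>cube. l0norm (z - x) \<le> \<epsilon> \<and> h z \<noteq> - 1} = \<dots>" .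
  show ?thesis unfolding adv_error_bernoulli_mixture left right reward_def by (simp add: field_simps)
qed

section \<open>Binomial tails and the error of thresholds\<close>

lemma set_pmf_binomial_subset: "p \<in> {0..1} \<Longrightarrow> set_pmf (binomial_pmf k p) \<subseteq> {..k}"
  by (auto simp: set_pmf_binomial_eq split: if_splits)

text \<open>Covers \<open>n > k\<close> as well, which occurs for large \<open>\<epsilon>\<close>:
  then the left side is empty and the sum on the right is 1.\<close>

lemma binomial_tail:
  assumes "p \<in> {0..1}"
  shows "sum (pmf (binomial_pmf k p)) {i. i \<le> k \<and> n \<le> i} = 1 - sum (pmf (binomial_pmf k p)) {..<n}"
proof -
  let ?b = "binomial_pmf k p" and ?T = "{i. i \<le> k \<and> n \<le> i}"
  have "sum (pmf ?b) ?T + sum (pmf ?b) {..<n} = sum (pmf ?b) (?T \<union> {..<n})"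
    by (rule sum.union_disjoint[symmetric]) auto
  also have "\<dots> = 1"
    using set_pmf_binomial_subset[OF assms, of k] by (intro sum_pmf_eq_1) auto
  finally show ?thesis by simp
qed

lemma adv_error_threshold:
  fixes \<theta>p \<theta>m :: "real ^ 'n"
  assumes cube: "\<theta>p \<in> cube" "\<theta>m \<in> cube" and t: "1/2 + t \<in> {0..1}"
    and h: "\<And>x. x \<in> cube \<Longrightarrow> h x = (if level \<theta>p \<theta>m x \<le> s then 1 else - 1)"
    and k: "k = l0norm (\<theta>p - \<theta>m)" and "s < k"
  shows "adv_error \<epsilon> h (bernoulli_mixture \<theta>p \<theta>m t) =
      1/2 * (\<Sum>i = 0..s + \<epsilon>. real (k choose i) * (1/2 + t) ^ i * (1/2 - t) ^ (k - i)) +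
      1/2 * (\<Sum>i = 0..k - s + \<epsilon> - 1. real (k choose i) * (1/2 + t) ^ i * (1/2 - t) ^ (k - i))"
proof -
  let ?w = "pmf (binomial_pmf k (1/2 + t))"
  have w: "?w i = real (k choose i) * (1/2 + t) ^ i * (1/2 - t) ^ (k - i)" for i
    using t by simp
  have "core k \<epsilon> {..s} = {m. m \<le> k \<and> m + \<epsilon> \<le> s}"
  proof (intro set_eqI iffI)
    fix m assume m: "m \<in> core k \<epsilon> {..s}"
    have "m \<le> k" using m by (rule core_le)
    moreover have "m + \<epsilon> \<le> s"
    proof (rule ccontr)
      assume "\<not> m + \<epsilon> \<le> s"
      \<comment> \<open>If \<open>m \<le> s\<close>, the window of \<open>m\<close> contains
        \<open>Suc s\<close>, which is a level because \<open>s < k\<close>; otherwise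
        \<open>m\<close> itself is outside the set.\<close>
      then show False
        using coreD[OF m, of "Suc s"] coreD[OF m, of m] \<open>m \<le> k\<close> \<open>s < k\<close> by auto
    qed
    ultimately show "m \<in> {m. m \<le> k \<and> m + \<epsilon> \<le> s}" by simp
  qed (auto simp: core_def)
  then have "(\<Sum>m\<in>core k \<epsilon> {..s}. ?w (k - m)) = sum ?w {i. i \<le> k \<and> k - s + \<epsilon> \<le> i}"
    using \<open>s < k\<close>
    by (intro sum.reindex_bij_witness[of _ "\<lambda>m. k - m" "\<lambda>m. k - m"]) auto
  also have "\<dots> = 1 - sum ?w {..<k - s + \<epsilon>}" using t by (rule binomial_tail)
  \<comment> \<open>As \<open>s < k\<close>, the upper index \<open>k - s + \<epsilon> - 1\<close>
    is not truncated.\<close>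
  also have "{..<k - s + \<epsilon>} = {0..k - s + \<epsilon> - 1}" using \<open>s < k\<close> by auto
  finally have left: "(\<Sum>m\<in>core k \<epsilon> {..s}. ?w (k - m)) = 1 - sum ?w {0..k - s + \<epsilon> - 1}" .
  have "core k \<epsilon> (- {..s}) = {m. m \<le> k \<and> Suc (s + \<epsilon>) \<le> m}"
  proof (intro set_eqI iffI)
    fix m assume m: "m \<in> core k \<epsilon> (- {..s})"
    have "m \<le> k" using m by (rule core_le)
    \<comment> \<open>The lowest level of the window. Truncation at 0 cannot occur here, since 0 is
      not above \<open>s\<close>.\<close>
    moreover have "m - \<epsilon> \<in> - {..s}"
      using \<open>m \<le> k\<close> by (intro coreD[OF m]) linarith+
    ultimately show "m \<in> {m. m \<le> k \<and> Suc (s + \<epsilon>) \<le> m}" by simp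
  qed (auto simp: core_def)
  then have "sum ?w (core k \<epsilon> (- {..s})) = 1 - sum ?w {..<Suc (s + \<epsilon>)}"
    using binomial_tail[OF t] by simp
  also have "{..<Suc (s + \<epsilon>)} = {0..s + \<epsilon>}" by auto
  finally have right: "sum ?w (core k \<epsilon> (- {..s})) = 1 - sum ?w {0..s + \<epsilon>}" .
  have "adv_error \<epsilon> h (bernoulli_mixture \<theta>p \<theta>m t) = 1 - reward ?w k \<epsilon> {..s} / 2"
    using adv_error_level_classifier[OF cube t, of h "{..s}" \<epsilon>] h by (simp add: k)
  also have "\<dots> = 1/2 * sum ?w {0..s + \<epsilon>} + 1/2 * sum ?w {0..k - s + \<epsilon> - 1}"
    unfolding reward_def left right by (simp add: field_simps)
  finally show ?thesis unfolding w .
qed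

lemma optimal_rate_eq:
  assumes "optimal_robust \<epsilon> h D"
  shows "optimal_rate \<epsilon> D = adv_error \<epsilon> h D"
  unfolding optimal_rate_def
  by (rule cInf_eq_minimum) (use assms in \<open>auto simp: optimal_robust_def\<close>)

subsection \<open>Optimal classifiers\<close>

definition levelwise :: "real ^ 'n \<Rightarrow> real ^ 'n \<Rightarrow> (real ^ 'n \<Rightarrow> int) \<Rightarrow> bool" where
  "levelwise \<theta>p \<theta>m h \<longleftrightarrow>
     (\<forall>u\<in>cube. \<forall>v\<in>cube. level \<theta>p \<theta>m u = level \<theta>p \<theta>m v \<longrightarrow> h u = h v)"

lemma levelwiseD:
  "levelwise \<theta>p \<theta>m h \<Longrightarrow> u \<in> cube \<Longrightarrow> v \<in> cube \<Longrightarrow> level \<theta>p \<theta>m u = level \<theta>p \<theta>m v \<Longrightarrow> h u = h v"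
  unfolding levelwise_def by blast

text \<open>Being levelwise, \<open>h\<close> is given by a set \<open>A\<close> of levels.
  Comparing it with other level classifiers alone already makes the reward of \<open>A\<close>
  maximal.\<close>

lemma optimal_threshold_noisy:
  fixes \<theta>p \<theta>m :: "real ^ 'n"
  assumes cube: "\<theta>p \<in> cube" "\<theta>m \<in> cube" and t: "0 < t" "t < 1/2" and "0 < \<epsilon>"
    and opt: "optimal_robust \<epsilon> h (bernoulli_mixture \<theta>p \<theta>m t)"
    and lev: "levelwise \<theta>p \<theta>m h"
    and nonconst: "u \<in> cube" "v \<in> cube" "h u \<noteq> h v"
  shows "\<exists>s<l0norm (\<theta>p - \<theta>m). \<forall>x\<in>cube. h x = (if level \<theta>p \<theta>m x \<le> s then 1 else - 1)"
proof -
  define k where "k = l0norm (\<theta>p - \<theta>m)"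
  define A where "A = level \<theta>p \<theta>m ` {x \<in> cube. h x = 1}"
  let ?w = "pmf (binomial_pmf k (1/2 + t))"
  have pm: "h x = 1 \<or> h x = - 1" if "x \<in> cube" for x
    using opt that by (auto simp: optimal_robust_def classifiers_def)
  have A: "level \<theta>p \<theta>m x \<in> A \<longleftrightarrow> h x = 1" if "x \<in> cube" for x
  proof
    assume "level \<theta>p \<theta>m x \<in> A"
    then obtain y where y: "y \<in> cube" "h y = 1" "level \<theta>p \<theta>m x = level \<theta>p \<theta>m y"
      unfolding A_def by blast
    show "h x = 1" using levelwiseD[OF lev that y(1,3)] y(2) by simp
  qed (use that in \<open>simp add: A_def\<close>)
  have h: "h x = (if level \<theta>p \<theta>m x \<in> A then 1 else - 1)" if "x \<in> cube" for x
    using A[OF that] pm[OF that] by auto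
  have t01: "1/2 + t \<in> {0..1}" using t by simp
  have w: "?w i = real (k choose i) * (1/2 + t) ^ i * (1/2 - t) ^ (k - i)" for i
    using t by simp
  have pos: "0 < ?w i" if "i \<le> k" for i
    unfolding w using that t by simp
  have mono: "?w i \<le> ?w (k - i)" if "2 * i \<le> k" for i
  proof -
    \<comment> \<open>Cancelling the common factors reduces the claim to comparing the powers of
      \<open>1/2 - t\<close> and \<open>1/2 + t\<close> with exponent
      \<open>k - 2 * i\<close>.\<close>
    have pow: "a ^ (k - i) = a ^ i * a ^ (k - 2 * i)" for a :: real
      using that by (simp flip: power_add add: mult_2)
    have "(1/2 - t) ^ (k - 2 * i) \<le> (1/2 + t) ^ (k - 2 * i)"
      using t by (intro power_mono) auto
    then have "(1/2 + t) ^ i * (1/2 - t) ^ (k - i) \<le> (1/2 + t) ^ (k - i) * (1/2 - t) ^ i"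
      unfolding pow using t by (simp add: mult_ac mult_left_mono)
    then have "real (k choose i) * ((1/2 + t) ^ i * (1/2 - t) ^ (k - i))
        \<le> real (k choose i) * ((1/2 + t) ^ (k - i) * (1/2 - t) ^ i)"
      by (intro mult_left_mono) auto
    moreover have "k choose (k - i) = k choose i" "k - (k - i) = i"
      using that by (auto simp: binomial_symmetric[of i k])
    ultimately show ?thesis unfolding w by (simp add: mult.assoc)
  qed
  have max: "reward ?w k \<epsilon> B \<le> reward ?w k \<epsilon> A" for B
  proof -
    define g where "g x = (if level \<theta>p \<theta>m x \<in> B then 1 else - 1 :: int)" for x
    have "g \<in> classifiers" by (simp add: classifiers_def g_def)
    then have "adv_error \<epsilon> h (bernoulli_mixture \<theta>p \<theta>m t)
        \<le> adv_error \<epsilon> g (bernoulli_mixture \<theta>p \<theta>m t)"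
      using opt by (simp add: optimal_robust_def)
    then show ?thesis
      using adv_error_level_classifier[OF cube t01 h, of \<epsilon>]
        adv_error_level_classifier[OF cube t01 g_def, of \<epsilon>]
      by (simp add: k_def)
  qed
  have le: "level \<theta>p \<theta>m x \<le> k" for x unfolding k_def by (rule level_le)
  have "\<exists>a b. a \<in> cube \<and> b \<in> cube \<and> h a = 1 \<and> h b \<noteq> 1"
    using nonconst pm[of u] pm[of v] by (cases "h u = 1") force+
  then obtain a b where "a \<in> cube" "b \<in> cube" "h a = 1" "h b \<noteq> 1" by blast
  then have "\<exists>s<k. \<forall>j\<le>k. j \<in> A \<longleftrightarrow> j \<le> s"
    using A le
    by (intro threshold_if_maximal_reward[OF pos mono max \<open>0 < \<epsilon>\<close>,
          of "level \<theta>p \<theta>m a" "level \<theta>p \<theta>m b"]) auto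
  then obtain s where "s < k" "\<And>j. j \<le> k \<Longrightarrow> j \<in> A \<longleftrightarrow> j \<le> s" by blast
  then show ?thesis using h le unfolding k_def by auto
qed

section \<open>The noiseless case\<close>

definition robust_at :: "nat \<Rightarrow> (real ^ 'n \<Rightarrow> int) \<Rightarrow> real ^ 'n \<Rightarrow> int \<Rightarrow> bool" where
  "robust_at \<epsilon> h \<theta> c \<longleftrightarrow> (\<forall>z\<in>cube. l0norm (z - \<theta>) \<le> \<epsilon> \<longrightarrow> h z = c)"

lemma noisy_copy_half: "noisy_copy \<theta> (1/2) = return_pmf \<theta>"
proof -
  have "bernoulli_pmf 1 = return_pmf True"
    by (rule pmf_eqI) (simp add: indicator_def split: bool.split)
  then show ?thesis by (simp add: noisy_copy_def vec_eq_iff)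
qed

text \<open>Each conditional law is a point mass at its centre, so only robustness at the two
  centres counts.\<close>

lemma adv_error_noiseless:
  "adv_error \<epsilon> h (bernoulli_mixture \<theta>p \<theta>m (1/2)) =
    (of_bool (\<not> robust_at \<epsilon> h \<theta>p 1) + of_bool (\<not> robust_at \<epsilon> h \<theta>m (- 1))) / 2"
  unfolding adv_error_bernoulli_mixture noisy_copy_half robust_at_def
  by (simp add: measure_return_pmf indicator_def)

lemma robust_at_fun_upd:
  "robust_at \<epsilon> h \<theta> c \<Longrightarrow> \<epsilon> < l0norm (x - \<theta>) \<Longrightarrow> robust_at \<epsilon> (h(x := y)) \<theta> c"
  by (auto simp: robust_at_def)

text \<open>Stated for a label \<open>c\<close> because the roles of the two centres get swapped. An intermediate level
  contains a second point, so a levelwise rule flipped at a single point stops being levelwise.\<close>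

lemma threshold_if_flips_harm:
  fixes \<theta>p \<theta>m :: "real ^ 'n"
  assumes cube: "\<theta>p \<in> cube" "\<theta>m \<in> cube"
    and pm: "\<And>x. x \<in> cube \<Longrightarrow> h x = c \<or> h x = - c" and "c \<noteq> - c"
    and lev: "levelwise \<theta>p \<theta>m h"
    and robust: "robust_at \<epsilon> h \<theta>p c"
    and flips: "\<And>x. \<lbrakk>x \<in> cube; 0 < level \<theta>p \<theta>m x; level \<theta>p \<theta>m x < l0norm (\<theta>p - \<theta>m);
      robust_at \<epsilon> (h(x := - h x)) \<theta>p c\<rbrakk>
      \<Longrightarrow> robust_at \<epsilon> h \<theta>m (- c) \<and> \<not> robust_at \<epsilon> (h(x := - h x)) \<theta>m (- c)"
    and nonconst: "u \<in> cube" "v \<in> cube" "h u \<noteq> h v"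
  shows "\<exists>s<l0norm (\<theta>p - \<theta>m). \<forall>x\<in>cube. h x = (if level \<theta>p \<theta>m x \<le> s then c else - c)"
proof -
  define k where "k = l0norm (\<theta>p - \<theta>m)"
  let ?l = "level \<theta>p \<theta>m"
  have le: "?l x \<le> k" for x unfolding k_def by (rule level_le)
  have lev': "h x = h y" if "x \<in> cube" "y \<in> cube" "?l x = ?l y" for x y
    using levelwiseD[OF lev that] .
  \<comment> \<open>Every level up to \<open>\<epsilon>\<close> has a point in the ball about
    \<open>\<theta>p\<close>, and its label is shared by the whole level.\<close>
  have near: "h x = c" if x: "x \<in> cube" and "?l x \<le> \<epsilon>" for x
  proof -
    obtain z where "z \<in> cube" "?l z = ?l x" "l0norm (z - \<theta>p) = ?l x"
      using exists_level[OF cube(1) cube(1) level_le, of \<theta>m x] by (auto simp: level_left)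
    then show ?thesis using lev'[OF x, of z] robust \<open>?l x \<le> \<epsilon>\<close> by (simp add: robust_at_def)
  qed
  \<comment> \<open>Such an \<open>x\<close> is outside the ball about \<open>\<theta>p\<close>, so
    by \<open>flips\<close> changing its label must destroy robustness at \<open>\<theta>m\<close>.
    This puts \<open>x\<close> in the ball about \<open>\<theta>m\<close>, where the label is
    \<open>- c\<close>.\<close>
  have far: "robust_at \<epsilon> h \<theta>m (- c) \<and> h x = - c" if x: "x \<in> cube" and "\<epsilon> < ?l x" "?l x < k" for x
  proof -
    have "?l x \<le> l0norm (x - \<theta>p)"
      using level_le_add[of \<theta>p \<theta>m x \<theta>p] by (simp add: level_left l0norm_minus_commute)
    then have "robust_at \<epsilon> (h(x := - h x)) \<theta>p c"
      using robust_at_fun_upd[OF robust] \<open>\<epsilon> < ?l x\<close> by simp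
    then have *: "robust_at \<epsilon> h \<theta>m (- c)" "\<not> robust_at \<epsilon> (h(x := - h x)) \<theta>m (- c)"
      using flips[OF x] that by (auto simp: k_def)
    then have "l0norm (x - \<theta>m) \<le> \<epsilon>" using robust_at_fun_upd by (metis not_le)
    with * x show ?thesis by (simp add: robust_at_def)
  qed
  show ?thesis
  \<comment> \<open>If \<open>h\<close> is robust at \<open>\<theta>m\<close>, the threshold is
    \<open>\<epsilon>\<close>. Otherwise \<open>far\<close> leaves no intermediate level above
    \<open>\<epsilon>\<close>, so only the top level can have label \<open>- c\<close>, and the
    threshold is \<open>k - 1\<close>.\<close>
  proof (cases "robust_at \<epsilon> h \<theta>m (- c)")
    case True
    then have "h \<theta>m = - c" using cube(2) by (simp add: robust_at_def l0norm_def)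
    then have top: "h x = - c" if "x \<in> cube" "?l x = k" for x
      using lev'[OF that(1) cube(2)] that(2) by (simp add: level_right k_def)
    have "\<epsilon> < k"
      using near[OF cube(2)] \<open>h \<theta>m = - c\<close> \<open>c \<noteq> - c\<close> by (force simp: level_right k_def)
    moreover have "h x = (if ?l x \<le> \<epsilon> then c else - c)" if "x \<in> cube" for x
      using near far top that le[of x] by (cases "?l x = k") auto
    ultimately show ?thesis unfolding k_def by blast
  next
    case False
    have c: "h x = c" if "x \<in> cube" "?l x < k" for x
      using far[of x] near[of x] that False by (meson not_le)
    obtain a where a: "a \<in> cube" "h a \<noteq> c" using nonconst by metis
    then have ak: "?l a = k" using c le[of a] by fastforce
    have "k \<noteq> 0"
      using nonconst le lev' by (metis le_zero_eq)
    moreover have "h x = (if ?l x \<le> k - 1 then c else - c)" if x: "x \<in> cube" for x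
    proof (cases "?l x = k")
      case True
      then show ?thesis using lev'[OF x a(1)] ak a pm[OF x] \<open>k \<noteq> 0\<close> by auto
    next
      case False
      then have "?l x < k" using le[of x] by simp
      then show ?thesis using c[OF x] by auto
    qed
    ultimately show ?thesis unfolding k_def by (intro exI[of _ "k - 1"]) (auto simp: k_def)
  qed
qed

text \<open>A flip at an intermediate level that did not raise the error would give another optimal
  classifier, levelwise by \<open>sym\<close>, although a second point of that level keeps its
  label. Hence such flips are harmful, and it remains to find a robust centre.\<close>

lemma optimal_threshold_noiseless:
  fixes \<theta>p \<theta>m :: "real ^ 'n"
  assumes cube: "\<theta>p \<in> cube" "\<theta>m \<in> cube"
    and sym: "\<And>g. optimal_robust \<epsilon> g (bernoulli_mixture \<theta>p \<theta>m (1/2)) \<Longrightarrow> levelwise \<theta>p \<theta>m g"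
    and opt: "optimal_robust \<epsilon> h (bernoulli_mixture \<theta>p \<theta>m (1/2))"
    and nonconst: "u \<in> cube" "v \<in> cube" "h u \<noteq> h v"
  shows "\<exists>s<l0norm (\<theta>p - \<theta>m). \<forall>x\<in>cube. h x = (if level \<theta>p \<theta>m x \<le> s then 1 else - 1)"
proof -
  define k where "k = l0norm (\<theta>p - \<theta>m)"
  let ?D = "bernoulli_mixture \<theta>p \<theta>m (1/2)"
  have pm: "h x = 1 \<or> h x = - 1" if "x \<in> cube" for x
    using opt that by (auto simp: optimal_robust_def classifiers_def)
  have lev: "levelwise \<theta>p \<theta>m h" using sym opt .
  have flips: "adv_error \<epsilon> h ?D < adv_error \<epsilon> (h(x := - h x)) ?D"
    if x: "x \<in> cube" and pos: "0 < level \<theta>p \<theta>m x" and less: "level \<theta>p \<theta>m x < k" for x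
  proof (rule ccontr)
    let ?g = "h(x := - h x)"
    assume "\<not> ?thesis"
    moreover have "?g \<in> classifiers"
      using opt by (auto simp: optimal_robust_def classifiers_def)
    ultimately have "levelwise \<theta>p \<theta>m ?g"
      using opt by (intro sym) (force simp: optimal_robust_def)
    moreover obtain y where y: "y \<in> cube" "y \<noteq> x" "level \<theta>p \<theta>m y = level \<theta>p \<theta>m x"
      using exists_other_same_level[OF x cube(1) pos less[unfolded k_def]] .
    ultimately have "?g y = ?g x" "h y = h x"
      using lev x by (blast intro: levelwiseD)+
    then have "- h x = h x" using y(2) by simp
    then show False using pm[OF x] by auto
  qed
  \<comment> \<open>The constant 1 has error at most 1/2, so an optimal classifier cannot fail at
    both centres.\<close>
  have "(\<lambda>_. 1) \<in> (classifiers :: (real ^ 'n \<Rightarrow> int) set)" by (simp add: classifiers_def)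
  then have "adv_error \<epsilon> h ?D \<le> adv_error \<epsilon> (\<lambda>_. 1) ?D" using opt by (simp add: optimal_robust_def)
  moreover have "robust_at \<epsilon> (\<lambda>_. 1) \<theta>p 1" by (simp add: robust_at_def)
  ultimately have "robust_at \<epsilon> h \<theta>p 1 \<or> robust_at \<epsilon> h \<theta>m (- 1)"
    by (auto simp: adv_error_noiseless of_bool_def split: if_splits)
  then show ?thesis
  proof
    assume r: "robust_at \<epsilon> h \<theta>p 1"
    show ?thesis
    proof (rule threshold_if_flips_harm[OF cube _ _ lev r _ nonconst])
      fix x assume x: "x \<in> cube" "0 < level \<theta>p \<theta>m x" "level \<theta>p \<theta>m x < l0norm (\<theta>p - \<theta>m)"
        "robust_at \<epsilon> (h(x := - h x)) \<theta>p 1"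
      \<comment> \<open>The term of \<open>\<theta>p\<close> is 0 before and after the flip, so the
        strict rise comes from \<open>\<theta>m\<close>.\<close>
      from flips[OF x(1,2) x(3)[folded k_def]] x(4)
      show "robust_at \<epsilon> h \<theta>m (- 1) \<and> \<not> robust_at \<epsilon> (h(x := - h x)) \<theta>m (- 1)"
        by (auto simp: adv_error_noiseless of_bool_def r split: if_splits)
    qed (use pm in auto)
  next
    assume r: "robust_at \<epsilon> h \<theta>m (- 1)"
    have swap: "level \<theta>m \<theta>p x = k - level \<theta>p \<theta>m x" if "x \<in> cube" for x
      using level_swap[OF cube that] by (simp add: k_def)
    have le: "level \<theta>p \<theta>m x \<le> k" for x unfolding k_def by (rule level_le)
    have lev': "levelwise \<theta>m \<theta>p h"
      using lev le unfolding levelwise_def by (metis swap diff_diff_cancel)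
    have "\<exists>s<k. \<forall>x\<in>cube. h x = (if level \<theta>m \<theta>p x \<le> s then - 1 else - (- 1))"
      unfolding k_def l0norm_minus_commute[of \<theta>p]
    proof (rule threshold_if_flips_harm[OF cube(2,1) _ _ lev' r _ nonconst])
      fix x assume x: "x \<in> cube" "0 < level \<theta>m \<theta>p x" "level \<theta>m \<theta>p x < l0norm (\<theta>m - \<theta>p)"
        "robust_at \<epsilon> (h(x := - h x)) \<theta>m (- 1)"
      then have "0 < level \<theta>p \<theta>m x" "level \<theta>p \<theta>m x < k"
        using swap[OF x(1)] by (auto simp: k_def l0norm_minus_commute[of \<theta>p])
      from flips[OF x(1) this] x(4)
      show "robust_at \<epsilon> h \<theta>p (- (- 1)) \<and> \<not> robust_at \<epsilon> (h(x := - h x)) \<theta>p (- (- 1))"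
        by (auto simp: adv_error_noiseless of_bool_def r split: if_splits)
    qed (use pm in auto)
    then obtain s where "s < k" and s: "\<And>x. x \<in> cube \<Longrightarrow> h x = (if level \<theta>m \<theta>p x \<le> s then - 1 else 1)"
      by auto
    \<comment> \<open>Levels at most \<open>s\<close> counted from \<open>\<theta>m\<close> are
      those at least \<open>k - s\<close> counted from \<open>\<theta>p\<close>.\<close>
    have "h x = (if level \<theta>p \<theta>m x \<le> k - s - 1 then 1 else - 1)" if "x \<in> cube" for x
      using s[OF that] swap[OF that] le[of x] \<open>s < k\<close> by auto
    moreover have "k - s - 1 < k" using \<open>s < k\<close> by simp
    ultimately show ?thesis unfolding k_def by blast
  qed
qed

theorem theorem4:
  fixes \<theta>p \<theta>m :: "real ^ 'n" and t :: real and k \<epsilon> :: nat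
    and D :: "((real ^ 'n) \<times> int) pmf" and h :: "real ^ 'n \<Rightarrow> int"
  assumes "\<theta>p \<in> cube" and "\<theta>m \<in> cube"
    and "0 < t" and "t \<le> 1/2"
    and "D = bernoulli_mixture \<theta>p \<theta>m t"
    and "k = l0norm (\<theta>p - \<theta>m)"
    and "0 < \<epsilon>"
    and symmetric: "\<And>g u v. \<lbrakk>optimal_robust \<epsilon> g D; u \<in> cube; v \<in> cube;
           l0norm (restrict_diff \<theta>p \<theta>m u - restrict_diff \<theta>p \<theta>m \<theta>p) =
           l0norm (restrict_diff \<theta>p \<theta>m v - restrict_diff \<theta>p \<theta>m \<theta>p)\<rbrakk> \<Longrightarrow> g u = g v"
    and "optimal_robust \<epsilon> h D"
    and nonconstant: "\<exists>u\<in>cube. \<exists>v\<in>cube. h u \<noteq> h v"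
  shows "\<exists>s\<in>{0..k}.
    (\<forall>x\<in>cube. h x =
       (if l0norm (restrict_diff \<theta>p \<theta>m x - restrict_diff \<theta>p \<theta>m \<theta>p) \<le> s then 1 else - 1)) \<and>
    optimal_rate \<epsilon> D =
      1/2 * (\<Sum>i = 0..s + \<epsilon>. real (k choose i) * (1/2 + t) ^ i * (1/2 - t) ^ (k - i)) +
      1/2 * (\<Sum>i = 0..k - s + \<epsilon> - 1. real (k choose i) * (1/2 + t) ^ i * (1/2 - t) ^ (k - i))"
proof -
  note D = assms(5) and k = assms(6)
  have sym: "levelwise \<theta>p \<theta>m g" if "optimal_robust \<epsilon> g D" for g
    using symmetric[OF that] unfolding levelwise_def level_def by blast
  obtain u v where uv: "u \<in> cube" "v \<in> cube" "h u \<noteq> h v" using nonconstant by blast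
  have "\<exists>s<k. \<forall>x\<in>cube. h x = (if level \<theta>p \<theta>m x \<le> s then 1 else - 1)"
  proof (cases "t = 1/2")
    case True
    show ?thesis
      using optimal_threshold_noiseless[OF assms(1,2) _ _ uv, of \<epsilon>] sym assms(9)
      by (simp add: True D k)
  next
    case False
    then show ?thesis
      using optimal_threshold_noisy[OF assms(1,2) \<open>0 < t\<close> _ \<open>0 < \<epsilon>\<close> _ sym[OF assms(9)] uv]
        assms(4,9) by (simp add: D k)
  qed
  then obtain s where "s < k"
    and s: "\<And>x. x \<in> cube \<Longrightarrow> h x = (if level \<theta>p \<theta>m x \<le> s then 1 else - 1)" by blast
  have "1/2 + t \<in> {0..1}" using assms(3,4) by simp
  from adv_error_threshold[OF assms(1,2) this s k \<open>s < k\<close>, of \<epsilon>]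
  show ?thesis
    using s \<open>s < k\<close> unfolding optimal_rate_eq[OF assms(9)] unfolding D level_def[symmetric]
    by (intro bexI[of _ s]) auto
qed

end
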